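(* Let $p=(f,g,A,a)\in\Gamma_{m,n}$ be a (separable) FR representation. For every $I\sqcup\bar I=\{1,\ldots,n\}$ and $z\in\mathbb R^{\bar I}$, $S^F_{I,z}$ and $S^S_{I,z}$ are equivariant under FR duality: \[ \left(S^{F}_{I,z}(p)\right)^*=S^{S}_{I,z}(p^* ). \] Symmetrically, for every $J\sqcup\bar J=\{1,\ldots,m\}$ and $s\in\mathbb R^{\bar J}$, \[ \left(S^{S}_{J,s}(p)\right)^*=S^{F}_{J,s}(p^* ). \]
   Context: Functions take values in $\overline{\mathbb R}=\mathbb R\cup\{+\infty\}$. For $\varphi:\mathbb R^\ell\to\overline{\mathbb R}$, the Fenchel conjugate is $\varphi^*(y)=\sup_{x\in\mathbb R^\ell}\{\langle y,x\rangle-\varphi(x)\}$. FR (Fenchel--Rockafellar) representations: an FR representation of size $(m,n)$ is a quadruple $p=(f,g,A,a)$ with $A\in\mathbb R^{m\times n}$, $a\in\mathbb R$, and closed proper convex functions $f:\mathbb R^m\to\overline{\mathbb R}$, $g:\mathbb R^n\to\overline{\mathbb R}$. It encodes, and is identified with, the objective function $p(x)=f(Ax)+g(x)+a$. $\Gamma_{m,n}$ denotes the class of those of size $(m,n)$, and $\Gamma$ the class of those of any size. Throughout, $f$ and $g$ are assumed separable: $f(y)=\sum_{j=1}^m f_j(y_j)$ and $g(x)=\sum_{i=1}^n g_i(x_i)$, with each $f_j$ and $g_i$ closed, proper, and convex on $\mathbb R$. The conjugates $f^*$ and $g^*$ are then separable with components $f_j^*$ and $g_i^*$. Index notation: $I\sqcup\bar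 I=N$ means that $I$ and $\bar I$ partition $N$. Write $x_I=(x_i)_{i\in I}$ and $g_I(x_I)=\sum_{i\in I}g_i(x_i)$, and define $f_J$ similarly; $f_{\bar J}^*$ is the conjugate of $f_{\bar J}$. For a set $I$ of column indices, $A_I$ is the submatrix of columns of $A$ indexed by $I$; for a set $J$ of row indices, $A_J$ is the submatrix of rows of $A$ indexed by $J$. FR dual: $p^*:=(g^*,f^*,-A^\top,-a)\in\Gamma_{n,m}$. (The symbol $^*$ is the Fenchel conjugate on functions and the FR dual on FR representations.) Transformations $F,G$ of $\Gamma$ are called equivariant under FR duality if $(F(p))^*=G(p^* )$ for all $p$. Translations of a function $\varphi$: $(T^{\mathrm d}_b\varphi)(y)=\varphi(y+b)$ and $(T^{\mathrm s}_d\varphi)(y)=\varphi(y)+\langle d,y\rangle$. Feature screening of $p\in\Gamma_{m,n}$ at $(I,z)$, where $I\sqcup\bar I=\{1,\ldots,n\}$ and $z\in\mathbb R^{\bar I}$ (column submatrices): \[S^F_{I,z}(p):=\bigl(T^{\mathrm d}_{A_{\bar I}z}f,\;g_I,\;A_I,\;a+g_{\bar I}(z)\bigr).\] Sample screening of $p\in\Gamma_{m,n}$ at $(J,s)$, where $J\sqcup\bar J=\{1,\ldots,m\}$ and $s\in\mathbb R^{\bar J}$ (row submatrices): \[S^S_{J,s}(p):=\bigl(f_J,\;T^{\mathrm s}_{A_{\bar J}^{\top}s}g,\;A_J,\;a-f_{\bar J}^{*}(s)\bigr).\] The same definitions apply to FR representations of any size. For $p^*\in\Gamma_{n,m}$,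 whose matrix is $-A^\top$, row indices are $\{1,\ldots,n\}$ and column indices are $\{1,\ldots,m\}$, which is how $S^S_{I,z}(p^* )$ and $S^F_{J,s}(p^* )$ are to be read. *)

theory Defs
  imports "HOL-Analysis.Analysis"
begin

text \<open>
  Screening passes from vectors indexed by \<open>{1..n}\<close> to vectors indexed by a subset \<open>I\<close>, so vectors
  and matrices are indexed by finite sets of natural numbers: \<open>\<real>\<^sup>I\<close> is \<open>I \<rightarrow>\<^sub>E UNIV\<close> and an
  \<open>R \<times> C\<close> matrix is an element of \<open>R \<times> C \<rightarrow>\<^sub>E UNIV\<close>.  Functions on \<open>\<real>\<^sup>I\<close> are likewise
  extensional, so that HOL equality is equality on \<open>\<real>\<^sup>I\<close>.
\<close>

type_synonym rvec = "nat \<Rightarrow> real"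
type_synonym rmat = "nat \<times> nat \<Rightarrow> real"

definition Rvec :: "nat set \<Rightarrow> rvec set" where
  "Rvec I = I \<rightarrow>\<^sub>E UNIV"

definition Rmat :: "nat set \<Rightarrow> nat set \<Rightarrow> rmat set" where
  "Rmat R C = R \<times> C \<rightarrow>\<^sub>E UNIV"

definition inner_on :: "nat set \<Rightarrow> rvec \<Rightarrow> rvec \<Rightarrow> real" where
  "inner_on I x y = (\<Sum>i\<in>I. x i * y i)"

definition mat_vec :: "nat set \<Rightarrow> nat set \<Rightarrow> rmat \<Rightarrow> rvec \<Rightarrow> rvec" where
  "mat_vec R C A x = (\<lambda>j\<in>R. \<Sum>i\<in>C. A (j, i) * x i)"

definition transp :: "nat set \<Rightarrow> nat set \<Rightarrow> rmat \<Rightarrow> rmat" where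
  "transp R C A = (\<lambda>(i, j)\<in>C \<times> R. A (j, i))"

definition neg_mat :: "nat set \<Rightarrow> nat set \<Rightarrow> rmat \<Rightarrow> rmat" where
  "neg_mat R C A = (\<lambda>k\<in>R \<times> C. - A k)"

definition submat :: "nat set \<Rightarrow> nat set \<Rightarrow> rmat \<Rightarrow> rmat" where
  "submat R C A = restrict A (R \<times> C)"


definition proper :: "(real \<Rightarrow> ereal) \<Rightarrow> bool" where
  "proper \<phi> \<longleftrightarrow> (\<forall>x. \<phi> x \<noteq> -\<infinity>) \<and> (\<exists>x. \<phi> x \<noteq> \<infinity>)"

definition epigraph :: "(real \<Rightarrow> ereal) \<Rightarrow> (real \<times> real) set" where
  "epigraph \<phi> = {(x, r). \<phi> x \<le> ereal r}"

definition closed_proper_convex :: "(real \<Rightarrow> ereal) \<Rightarrow> bool" where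
  "closed_proper_convex \<phi> \<longleftrightarrow> closed (epigraph \<phi>) \<and> proper \<phi> \<and> convex (epigraph \<phi>)"

definition conjugate :: "nat set \<Rightarrow> (rvec \<Rightarrow> ereal) \<Rightarrow> rvec \<Rightarrow> ereal" where
  "conjugate I \<phi> = (\<lambda>y\<in>Rvec I. SUP x\<in>Rvec I. ereal (inner_on I y x) - \<phi> x)"

definition conjugate1 :: "(real \<Rightarrow> ereal) \<Rightarrow> real \<Rightarrow> ereal" where
  "conjugate1 \<phi> y = (SUP x. ereal (y * x) - \<phi> x)"

definition dom_translate :: "nat set \<Rightarrow> rvec \<Rightarrow> (rvec \<Rightarrow> ereal) \<Rightarrow> rvec \<Rightarrow> ereal" where
  "dom_translate I b \<phi> = (\<lambda>y\<in>Rvec I. \<phi> (\<lambda>i\<in>I. y i + b i))"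

definition slope_translate :: "nat set \<Rightarrow> rvec \<Rightarrow> (rvec \<Rightarrow> ereal) \<Rightarrow> rvec \<Rightarrow> ereal" where
  "slope_translate I d \<phi> = (\<lambda>y\<in>Rvec I. \<phi> y + ereal (inner_on I d y))"

definition separable_sum :: "nat set \<Rightarrow> (nat \<Rightarrow> real \<Rightarrow> ereal) \<Rightarrow> rvec \<Rightarrow> ereal" where
  "separable_sum I c = (\<lambda>x\<in>Rvec I. \<Sum>i\<in>I. c i (x i))"


text \<open>
  A separable function determines its components only up to additive constants, while \<open>g\<^sub>I\<close>
  depends on the chosen components.  A separable function is therefore a function \<open>sf_val\<close> on
  \<open>\<real>\<^sup>I\<close> together with its components \<open>sf_comp\<close>; every operation acts on \<open>sf_val\<close> by its definition on
  \<open>\<real>\<^sup>I\<close> and records the components of the result.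
\<close>

record sepfun =
  sf_idx :: "nat set"
  sf_val :: "rvec \<Rightarrow> ereal"
  sf_comp :: "nat \<Rightarrow> real \<Rightarrow> ereal"

text \<open>
  A finite sum of closed proper convex functions of distinct coordinates is again closed, proper
  and convex, so these properties are required of the components only.
\<close>

definition is_sepfun :: "nat set \<Rightarrow> sepfun \<Rightarrow> bool" where
  "is_sepfun I \<phi> \<longleftrightarrow>
     finite I \<and> sf_idx \<phi> = I \<and> sf_comp \<phi> \<in> extensional I \<and>
     (\<forall>i\<in>I. closed_proper_convex (sf_comp \<phi> i)) \<and>
     sf_val \<phi> = separable_sum I (sf_comp \<phi>)"

definition sf_conjugate :: "sepfun \<Rightarrow> sepfun" where
  "sf_conjugate \<phi> = \<lparr> sf_idx = sf_idx \<phi>,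
     sf_val = conjugate (sf_idx \<phi>) (sf_val \<phi>),
     sf_comp = (\<lambda>i\<in>sf_idx \<phi>. conjugate1 (sf_comp \<phi> i)) \<rparr>"

definition sf_sub :: "nat set \<Rightarrow> sepfun \<Rightarrow> sepfun" where
  "sf_sub I \<phi> = \<lparr> sf_idx = I,
     sf_val = separable_sum I (sf_comp \<phi>),
     sf_comp = restrict (sf_comp \<phi>) I \<rparr>"

definition sf_dom_translate :: "rvec \<Rightarrow> sepfun \<Rightarrow> sepfun" where
  "sf_dom_translate b \<phi> = \<lparr> sf_idx = sf_idx \<phi>,
     sf_val = dom_translate (sf_idx \<phi>) b (sf_val \<phi>),
     sf_comp = (\<lambda>i\<in>sf_idx \<phi>. \<lambda>t. sf_comp \<phi> i (t + b i)) \<rparr>"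

definition sf_slope_translate :: "rvec \<Rightarrow> sepfun \<Rightarrow> sepfun" where
  "sf_slope_translate d \<phi> = \<lparr> sf_idx = sf_idx \<phi>,
     sf_val = slope_translate (sf_idx \<phi>) d (sf_val \<phi>),
     sf_comp = (\<lambda>i\<in>sf_idx \<phi>. \<lambda>t. sf_comp \<phi> i t + ereal (d i * t)) \<rparr>"


text \<open>
  The constant has type \<^typ>\<open>ereal\<close> because \<open>a + g\<^bsub>-I\<^esub>(z)\<close> is infinite when \<open>z\<close> is outside the
  domain of \<open>g\<^bsub>-I\<^esub>\<close>, where \<open>-I\<close> is the complement of \<open>I\<close>; members of \<open>\<Gamma>\<close> have a real constant.
\<close>

record fr_rep =
  fr_f :: sepfun
  fr_g :: sepfun
  fr_A :: rmat
  fr_a :: ereal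

abbreviation fr_rows :: "fr_rep \<Rightarrow> nat set" where
  "fr_rows p \<equiv> sf_idx (fr_f p)"

abbreviation fr_cols :: "fr_rep \<Rightarrow> nat set" where
  "fr_cols p \<equiv> sf_idx (fr_g p)"

definition Gamma_FR :: "nat \<Rightarrow> nat \<Rightarrow> fr_rep set" where
  "Gamma_FR m n = {p. is_sepfun {1..m} (fr_f p) \<and> is_sepfun {1..n} (fr_g p) \<and>
     fr_A p \<in> Rmat {1..m} {1..n} \<and> (\<exists>a::real. fr_a p = ereal a)}"

definition fr_objective :: "fr_rep \<Rightarrow> rvec \<Rightarrow> ereal" where
  "fr_objective p x =
     sf_val (fr_f p) (mat_vec (fr_rows p) (fr_cols p) (fr_A p) x) + sf_val (fr_g p) x + fr_a p"

definition fr_dual :: "fr_rep \<Rightarrow> fr_rep" where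
  "fr_dual p = \<lparr> fr_f = sf_conjugate (fr_g p),
     fr_g = sf_conjugate (fr_f p),
     fr_A = neg_mat (fr_cols p) (fr_rows p) (transp (fr_rows p) (fr_cols p) (fr_A p)),
     fr_a = - fr_a p \<rparr>"

definition feature_screen :: "nat set \<Rightarrow> rvec \<Rightarrow> fr_rep \<Rightarrow> fr_rep" where
  "feature_screen I z p =
     (let R = fr_rows p; I' = fr_cols p - I in
      \<lparr> fr_f = sf_dom_translate (mat_vec R I' (submat R I' (fr_A p)) z) (fr_f p),
        fr_g = sf_sub I (fr_g p),
        fr_A = submat R I (fr_A p),
        fr_a = fr_a p + sf_val (sf_sub I' (fr_g p)) z \<rparr>)"

definition sample_screen :: "nat set \<Rightarrow> rvec \<Rightarrow> fr_rep \<Rightarrow> fr_rep" where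
  "sample_screen J s p =
     (let C = fr_cols p; J' = fr_rows p - J in
      \<lparr> fr_f = sf_sub J (fr_f p),
        fr_g = sf_slope_translate
                 (mat_vec C J' (transp J' C (submat J' C (fr_A p))) s) (fr_g p),
        fr_A = submat J C (fr_A p),
        fr_a = fr_a p - sf_val (sf_conjugate (sf_sub J' (fr_f p))) s \<rparr>)"

end

theory Submission
  imports Defs
begin

text \<open>
  Conjugation exchanges domain and slope translations and, for separable functions, commutes with
  the restriction to a set of coordinates.  The only analytic point is the constant of
  \<open>(S\<^sup>F(p))\<^sup>*\<close>: it requires the biconjugate of each \<open>g\<^sub>i\<close> to be \<open>g\<^sub>i\<close> (Fenchel--Moreau in
  one variable), which follows by separating a point below the graph from the closed convex epigraph.
\<close>

section \<open>Conjugation in one variable\<close>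

text \<open>The Fenchel-Young inequality, arranged so that it bounds every term of the supremum
  defining the biconjugate.\<close>

lemma conjugate1_upper:
  assumes "\<phi> x \<noteq> -\<infinity>"
  shows "ereal (y * x) - conjugate1 \<phi> y \<le> \<phi> x"
proof -
  have "ereal (y * x) - \<phi> x \<le> conjugate1 \<phi> y"
    unfolding conjugate1_def by (rule SUP_upper) simp
  then show ?thesis
    using assms by (cases "\<phi> x"; cases "conjugate1 \<phi> y") (auto simp: algebra_simps)
qed

lemma conjugate1_le_of_minorant:
  assumes "\<And>t. ereal (y * t + c) \<le> \<phi> t"
  shows "conjugate1 \<phi> y \<le> ereal (- c)"
  unfolding conjugate1_def
proof (rule SUP_least)
  fix t show "ereal (y * t) - \<phi> t \<le> ereal (- c)"
    using assms[of t] by (cases "\<phi> t") (auto simp: algebra_simps)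
qed

text \<open>The point \<open>(x, r)\<close> lies off the closed convex epigraph, so a line separates
  them strictly. The sign of \<open>q\<close> comes from the epigraph being closed upwards: with
  \<open>q < 0\<close>, moving up a vertical ray would push \<open>p * t + q * s\<close> below
  \<open>b\<close>.\<close>

lemma epigraph_separation:
  assumes "closed_proper_convex \<phi>" "ereal r < \<phi> x"
  obtains p q b where "q \<ge> 0" "p * x + q * r < b"
    "\<And>t s. \<phi> t \<le> ereal s \<Longrightarrow> b < p * t + q * s"
proof -
  have "closed (epigraph \<phi>)" "convex (epigraph \<phi>)" "(x, r) \<notin> epigraph \<phi>"
    using assms by (auto simp: closed_proper_convex_def epigraph_def)
  then obtain a b where ab: "a \<bullet> (x, r) < b" "\<forall>z\<in>epigraph \<phi>. a \<bullet> z > b"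
    using separating_hyperplane_closed_point by blast
  obtain p q where [simp]: "a = (p, q)" by (cases a)
  have sep: "b < p * t + q * s" if "\<phi> t \<le> ereal s" for t s
    using ab(2) that by (auto simp: epigraph_def)
  have "q \<ge> 0"
  proof (rule ccontr)
    assume "\<not> q \<ge> 0"
    obtain t s where "\<phi> t = ereal s"
      using assms(1) unfolding closed_proper_convex_def proper_def
      by (metis ereal_cases)
    moreover define s' where "s' = max s ((b - p * t) / q)"
    ultimately have "b < p * t + q * s'" by (intro sep) simp
    moreover have "q * s' \<le> q * ((b - p * t) / q)"
      using \<open>\<not> q \<ge> 0\<close> by (intro mult_left_mono_neg) (auto simp: s'_def)
    ultimately show False using \<open>\<not> q \<ge> 0\<close> by simp
  qed
  with ab(1) sep that show ?thesis by auto
qed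

text \<open>With \<open>q > 0\<close> the separating line can be solved for the vertical coordinate,
  giving slope \<open>- p / q\<close> and intercept \<open>b / q\<close>.\<close>

lemma affine_minorant_of_nonvertical:
  fixes q :: real
  assumes "q > 0" "p * x + q * r < b"
    and "\<And>t s. \<phi> t \<le> ereal s \<Longrightarrow> b < p * t + q * s" and "\<And>t. \<phi> t \<noteq> -\<infinity>"
  shows "\<exists>y c. (\<forall>t. ereal (y * t + c) \<le> \<phi> t) \<and> r \<le> y * x + c"
proof (intro exI conjI allI)
  fix t show "ereal (- p / q * t + b / q) \<le> \<phi> t"
    using assms(1) assms(3)[of t "real_of_ereal (\<phi> t)"] assms(4)[of t]
    by (cases "\<phi> t") (auto simp: field_simps)
  show "r \<le> - p / q * x + b / q"
    using assms(1,2) by (simp add: field_simps)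
qed

text \<open>A nonvertical separator is itself such a minorant. A vertical one occurs only if
  \<open>\<phi> x = \<infinity>\<close>; then a minorant found at a point of the domain is tilted
  along it.\<close>

lemma affine_minorant:
  assumes "closed_proper_convex \<phi>" "ereal r < \<phi> x"
  shows "\<exists>y c. (\<forall>t. ereal (y * t + c) \<le> \<phi> t) \<and> r \<le> y * x + c"
proof -
  have ninf: "\<phi> t \<noteq> -\<infinity>" for t
    using assms(1) by (simp add: closed_proper_convex_def proper_def)
  obtain p q b where pqb: "q \<ge> 0" "p * x + q * r < b"
      "\<And>t s. \<phi> t \<le> ereal s \<Longrightarrow> b < p * t + q * s"
    by (rule epigraph_separation[OF assms]) (rule that)
  show ?thesis
  proof (cases "q = 0")
    case False
    then have "q > 0" using pqb(1) by simp
    then show ?thesis using pqb(2,3) ninf by (rule affine_minorant_of_nonvertical)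
  next
    case True
    obtain x0 s0 where x0: "\<phi> x0 = ereal s0"
      using assms(1) unfolding closed_proper_convex_def proper_def
      by (metis ereal_cases)
    \<comment> \<open>A hyperplane separating a point below the graph at \<open>x0 \<in> dom \<phi>\<close> cannot be vertical.\<close>
    obtain p' q' b' where pqb': "q' \<ge> 0" "p' * x0 + q' * (s0 - 1) < b'"
        "\<And>t s. \<phi> t \<le> ereal s \<Longrightarrow> b' < p' * t + q' * s"
      by (rule epigraph_separation[OF assms(1), of "s0 - 1" x0]) (simp add: x0, rule that)
    \<comment> \<open>If \<open>q' = 0\<close>, the separated point gives
      \<open>p' * x0 < b'\<close> and the graph point \<open>(x0, s0)\<close> gives
      \<open>b' < p' * x0\<close>.\<close>
    have "q' > 0"
      using pqb'(1,2) pqb'(3)[of x0 s0] x0 by (auto simp: algebra_simps order_le_less)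
    then obtain y c where yc: "\<And>t. ereal (y * t + c) \<le> \<phi> t"
      using affine_minorant_of_nonvertical[where \<phi> = \<phi>, OF _ pqb'(2,3) ninf] by blast
    \<comment> \<open>Tilting by the vertical separator, negative on \<open>dom \<phi>\<close> and positive at \<open>x\<close>, lifts this
       minorant above \<open>r\<close> at \<open>x\<close>.\<close>
    define k where "k = \<bar>r - (y * x + c)\<bar> / (b - p * x)"
    have pos: "b - p * x > 0" using pqb(2) True by simp
    then have k: "k \<ge> 0" "k * (b - p * x) = \<bar>r - (y * x + c)\<bar>" by (simp_all add: k_def)
    show ?thesis
    proof (intro exI conjI allI)
      fix t show "ereal ((y - k * p) * t + (c + k * b)) \<le> \<phi> t"
      proof (cases "\<phi> t")
        case (real s)
        have "k * b \<le> k * (p * t)"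
          using pqb(3)[of t s] real True k(1) by (intro mult_left_mono) auto
        then show ?thesis using yc[of t] real by (auto simp: algebra_simps)
      qed (use ninf in auto)
      show "r \<le> (y - k * p) * x + (c + k * b)"
        using k(2) by (simp add: algebra_simps abs_if split: if_splits)
    qed
  qed
qed

theorem conjugate1_conjugate1:
  assumes "closed_proper_convex \<phi>"
  shows "conjugate1 (conjugate1 \<phi>) = \<phi>"
proof (rule ext, rule antisym)
  fix x
  have ninf: "\<phi> x \<noteq> -\<infinity>"
    using assms by (simp add: closed_proper_convex_def proper_def)
  show "conjugate1 (conjugate1 \<phi>) x \<le> \<phi> x"
    unfolding conjugate1_def[of "conjugate1 \<phi>"]
    using conjugate1_upper[of \<phi> x] ninf by (auto intro!: SUP_least simp: mult.commute)
  show "\<phi> x \<le> conjugate1 (conjugate1 \<phi>) x"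
  \<comment> \<open>Testing against real bounds \<open>u\<close> treats finite and infinite
    \<open>\<phi> x\<close> alike. If \<open>u < r < \<phi> x\<close>, a minorant of slope
    \<open>y\<close> reaching \<open>r\<close> at \<open>x\<close> makes the term at
    \<open>y\<close> of the biconjugate at least \<open>r\<close>.\<close>
  proof (rule ereal_le_real)
    fix u assume u: "conjugate1 (conjugate1 \<phi>) x \<le> ereal u"
    show "\<phi> x \<le> ereal u"
    proof (rule ccontr)
      assume "\<not> \<phi> x \<le> ereal u"
      then obtain r where r: "ereal u < ereal r" "ereal r < \<phi> x"
        by (metis ereal_dense2 not_le)
      obtain y c where yc: "\<And>t. ereal (y * t + c) \<le> \<phi> t" "r \<le> y * x + c"
        using affine_minorant[OF assms r(2)] by blast
      have "ereal r \<le> ereal (x * y) - ereal (- c)"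
        using yc(2) by (simp add: mult.commute)
      also have "\<dots> \<le> ereal (x * y) - conjugate1 \<phi> y"
        by (intro ereal_minus_mono conjugate1_le_of_minorant yc order_refl)
      also have "\<dots> \<le> conjugate1 (conjugate1 \<phi>) x"
        unfolding conjugate1_def[of "conjugate1 \<phi>"] by (rule SUP_upper) simp
      finally show False using u r(1) by (meson leD order_trans)
    qed
  qed
qed

text \<open>A finite value of \<open>\<phi>\<close> keeps the conjugate above
  \<open>-\<infinity>\<close>, and an affine minorant of slope \<open>y\<close> makes it finite at
  \<open>y\<close>. This permits conjugating a separable sum of conjugates.\<close>

lemma proper_conjugate1:
  assumes "closed_proper_convex \<phi>"
  shows "proper (conjugate1 \<phi>)"
proof -
  obtain x s where x: "\<phi> x = ereal s"
    using assms unfolding closed_proper_convex_def proper_def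
    by (metis ereal_cases)
  have "ereal (y * x) - \<phi> x \<le> conjugate1 \<phi> y" for y
    unfolding conjugate1_def by (rule SUP_upper) simp
  then have "conjugate1 \<phi> y \<noteq> -\<infinity>" for y
    using x by (metis MInfty_neq_ereal(1) ereal_infty_less_eq(2) ereal_minus(1))
  moreover obtain y c where "\<And>t. ereal (y * t + c) \<le> \<phi> t"
    using affine_minorant[OF assms, of "s - 1" x] x by auto
  then have "conjugate1 \<phi> y \<noteq> \<infinity>"
    using conjugate1_le_of_minorant by (metis ereal_infty_less_eq(1) PInfty_neq_ereal(1))
  ultimately show ?thesis by (auto simp: proper_def)
qed

text \<open>Substitute \<open>t - b\<close> for \<open>t\<close>. The one-variable rules handle the
  recorded components \<open>sf_comp\<close>; their analogues on \<open>Rvec I\<close> handle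
  \<open>sf_val\<close>.\<close>

lemma conjugate1_dom_translate:
  "conjugate1 (\<lambda>t. \<phi> (t + b)) y = conjugate1 \<phi> y + ereal (- b * y)"
proof -
  have "conjugate1 (\<lambda>t. \<phi> (t + b)) y = (SUP t\<in>range (\<lambda>t. t + b). ereal (y * (t - b)) - \<phi> t)"
    unfolding conjugate1_def image_image by simp
  also have "range (\<lambda>t. t + b) = UNIV"
    by (rule surjI[of _ "\<lambda>t. t - b"]) simp
  also have "(SUP t. ereal (y * (t - b)) - \<phi> t) = (SUP t. ereal (y * t) - \<phi> t + ereal (- b * y))"
  proof (rule SUP_cong[OF refl])
    fix t show "ereal (y * (t - b)) - \<phi> t = ereal (y * t) - \<phi> t + ereal (- b * y)"
      by (cases "\<phi> t") (auto simp: algebra_simps)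
  qed
  also have "\<dots> = conjugate1 \<phi> y + ereal (- b * y)"
    unfolding conjugate1_def by (rule SUP_ereal_add_left) auto
  finally show ?thesis .
qed

lemma conjugate1_slope_translate:
  "conjugate1 (\<lambda>t. \<phi> t + ereal (d * t)) y = conjugate1 \<phi> (y - d)"
proof -
  have "ereal (y * t) - (\<phi> t + ereal (d * t)) = ereal ((y - d) * t) - \<phi> t" for t
    by (cases "\<phi> t") (auto simp: algebra_simps)
  then show ?thesis by (simp add: conjugate1_def)
qed


section \<open>Conjugation of functions of several variables\<close>

lemma sum_ereal_not_MInfty:
  fixes f :: "'i \<Rightarrow> ereal"
  assumes "\<And>i. i \<in> I \<Longrightarrow> f i \<noteq> -\<infinity>"
  shows "sum f I \<noteq> -\<infinity>"
  using assms by (induction I rule: infinite_finite_induct) auto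

text \<open>The supremum is reindexed by the translation, a bijection of \<open>Rvec I\<close>. The
  relation between \<open>d\<close> and \<open>b\<close> is stated on \<open>I\<close> because
  products such as \<open>mat_vec\<close> are \<open>undefined\<close> off their index set, which
  negation need not preserve.\<close>

lemma conjugate_dom_translate:
  assumes "\<And>i. i \<in> I \<Longrightarrow> d i = - b i"
  shows "conjugate I (dom_translate I b \<phi>) = slope_translate I d (conjugate I \<phi>)"
proof (rule ext)
  fix y
  show "conjugate I (dom_translate I b \<phi>) y = slope_translate I d (conjugate I \<phi>) y"
  proof (cases "y \<in> Rvec I")
    case True
    let ?\<tau> = "\<lambda>x. \<lambda>i\<in>I. x i + b i"
    have im: "?\<tau> ` Rvec I = Rvec I"
    proof (intro equalityI subsetI)
      fix x assume "x \<in> Rvec I"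
      then show "x \<in> ?\<tau> ` Rvec I"
        by (intro image_eqI[of _ _ "\<lambda>i\<in>I. x i - b i"])
          (auto simp: Rvec_def PiE_def extensional_def fun_eq_iff)
    qed (auto simp: Rvec_def)
    have inner: "inner_on I y x = inner_on I y (?\<tau> x) + inner_on I d y" for x
      unfolding inner_on_def sum.distrib[symmetric]
      by (intro sum.cong refl) (simp add: assms algebra_simps)
    have "conjugate I (dom_translate I b \<phi>) y
        = (SUP x\<in>Rvec I. ereal (inner_on I y x) - \<phi> (?\<tau> x))"
      using True by (simp add: conjugate_def dom_translate_def)
    also have "\<dots> = (SUP x\<in>?\<tau> ` Rvec I. ereal (inner_on I y x + inner_on I d y) - \<phi> x)"
      unfolding image_image by (intro SUP_cong refl) (subst inner, rule refl)
    also have "\<dots> = (SUP x\<in>Rvec I. ereal (inner_on I y x + inner_on I d y) - \<phi> x)"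
      unfolding im ..
    also have "\<dots> = (SUP x\<in>Rvec I. ereal (inner_on I y x) - \<phi> x + ereal (inner_on I d y))"
    proof (rule SUP_cong[OF refl])
      fix x show "ereal (inner_on I y x + inner_on I d y) - \<phi> x
          = ereal (inner_on I y x) - \<phi> x + ereal (inner_on I d y)"
        by (cases "\<phi> x") auto
    qed
    also have "\<dots> = (SUP x\<in>Rvec I. ereal (inner_on I y x) - \<phi> x) + ereal (inner_on I d y)"
      using True by (intro SUP_ereal_add_left) auto
    finally show ?thesis using True by (simp add: slope_translate_def conjugate_def)
  qed (simp add: conjugate_def slope_translate_def)
qed

lemma conjugate_slope_translate:
  assumes "\<And>i. i \<in> I \<Longrightarrow> b i = - d i"
  shows "conjugate I (slope_translate I d \<phi>) = dom_translate I b (conjugate I \<phi>)"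
proof (rule ext)
  fix y
  let ?y = "\<lambda>i\<in>I. y i + b i"
  have "ereal (inner_on I y x) - (\<phi> x + ereal (inner_on I d x)) = ereal (inner_on I ?y x) - \<phi> x" for x
  proof -
    have "inner_on I ?y x = inner_on I y x - inner_on I d x"
      unfolding inner_on_def sum_subtractf[symmetric]
      by (intro sum.cong refl) (simp add: assms algebra_simps)
    then show ?thesis by (cases "\<phi> x") auto
  qed
  moreover have "?y \<in> Rvec I" by (simp add: Rvec_def)
  ultimately show "conjugate I (slope_translate I d \<phi>) y = dom_translate I b (conjugate I \<phi>) y"
    by (simp add: conjugate_def slope_translate_def dom_translate_def)
qed

text \<open>
  Finiteness from below on each \<open>D i\<close> is needed because \<open>\<infinity> + (-\<infinity>) = \<infinity>\<close> in \<^typ>\<open>ereal\<close>.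
\<close>

lemma sum_SUP_PiE_ereal:
  fixes h :: "'i \<Rightarrow> 'a \<Rightarrow> ereal"
  assumes "finite I" "\<And>i. i \<in> I \<Longrightarrow> D i \<noteq> {}" "\<And>i x. i \<in> I \<Longrightarrow> x \<in> D i \<Longrightarrow> h i x \<noteq> -\<infinity>"
  shows "(\<Sum>i\<in>I. SUP x\<in>D i. h i x) = (SUP x\<in>Pi\<^sub>E I D. \<Sum>i\<in>I. h i (x i))"
  using assms
proof (induction I rule: finite_induct)
  case empty
  then show ?case by simp
next
  case (insert k I)
  let ?S = "\<lambda>x. \<Sum>i\<in>I. h i (x i)"
  have ne: "D k \<noteq> {}" "Pi\<^sub>E I D \<noteq> {}" using insert.prems(1) by (auto simp: PiE_eq_empty_iff)
  have S_ninf: "?S x \<noteq> -\<infinity>" if "x \<in> Pi\<^sub>E I D" for x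
    using that insert.prems(2) by (intro sum_ereal_not_MInfty) auto
  have SUP_ninf: "(SUP x\<in>Pi\<^sub>E I D. ?S x) \<noteq> -\<infinity>"
    using ne(2) S_ninf unfolding bot_ereal_def[symmetric] SUP_bot_conv by blast
  have split: "(\<Sum>i\<in>insert k I. h i ((x(k := t)) i)) = h k t + ?S x" for t x
  proof -
    have "(\<Sum>i\<in>I. h i ((x(k := t)) i)) = ?S x"
      using insert.hyps(2) by (intro sum.cong) auto
    then show ?thesis using insert.hyps by simp
  qed
  have "(\<Sum>i\<in>insert k I. SUP x\<in>D i. h i x) = (SUP t\<in>D k. h k t) + (SUP x\<in>Pi\<^sub>E I D. ?S x)"
    using insert by simp
  \<comment> \<open>Two constants enter suprema in turn: first the supremum over the remaining
    coordinates, then \<open>h k t\<close> for fixed \<open>t\<close>. Each must differ from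
    \<open>-\<infinity>\<close>.\<close>
  also have "\<dots> = (SUP t\<in>D k. h k t + (SUP x\<in>Pi\<^sub>E I D. ?S x))"
    using ne(1) SUP_ninf by (rule SUP_ereal_add_left[symmetric])
  also have "\<dots> = (SUP t\<in>D k. SUP x\<in>Pi\<^sub>E I D. h k t + ?S x)"
    using ne(2) insert.prems(2) by (intro SUP_cong refl SUP_ereal_add_right[symmetric]) auto
  also have "\<dots> = (SUP z\<in>D k \<times> Pi\<^sub>E I D. h k (fst z) + ?S (snd z))"
    by (simp add: SUP_pair)
  also have "\<dots> = (SUP x\<in>Pi\<^sub>E (insert k I) D. \<Sum>i\<in>insert k I. h i (x i))"
    unfolding PiE_insert_eq image_image by (simp only: split case_prod_unfold)
  finally show ?case .
qed

lemma separable_sum_cong: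
  assumes "I = J" "\<And>i. i \<in> J \<Longrightarrow> c i = c' i"
  shows "separable_sum I c = separable_sum J c'"
  using assms by (auto simp: separable_sum_def fun_eq_iff intro!: sum.cong)

text \<open>The objective splits into one term per coordinate, so the supremum over the product
  splits too. It is computed over the product of the domains \<open>D i\<close>, nonempty by
  properness, where no term is \<open>-\<infinity>\<close>.\<close>

lemma conjugate_separable_sum:
  assumes "finite I" "\<And>i. i \<in> I \<Longrightarrow> proper (c i)"
  shows "conjugate I (separable_sum I c) = separable_sum I (\<lambda>i. conjugate1 (c i))"
proof (rule ext)
  fix y
  show "conjugate I (separable_sum I c) y = separable_sum I (\<lambda>i. conjugate1 (c i)) y"
  proof (cases "y \<in> Rvec I")
    case True
    define h where "h i t = ereal (y i * t) - c i t" for i t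
    define D where "D i = {t. c i t \<noteq> \<infinity>}" for i
    have ninf: "c i t \<noteq> -\<infinity>" if "i \<in> I" for i t
      using assms(2)[OF that] by (simp add: proper_def)
    \<comment> \<open>Subtraction distributes over the sum because no \<open>c i\<close> takes the
      value \<open>-\<infinity>\<close>, so opposite infinities never meet.\<close>
    have h_sum: "ereal (inner_on I y x) - (\<Sum>i\<in>I. c i (x i)) = (\<Sum>i\<in>I. h i (x i))" for x
      using assms(1) ninf unfolding inner_on_def h_def
    proof (induction I rule: finite_induct)
      case (insert k I)
      have "(\<Sum>i\<in>I. c i (x i)) \<noteq> -\<infinity>"
        using insert.prems by (intro sum_ereal_not_MInfty) auto
      moreover have "c k (x k) \<noteq> -\<infinity>" using insert.prems by simp
      ultimately show ?case
        using insert by (cases "\<Sum>i\<in>I. c i (x i)"; cases "c k (x k)")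
          (auto simp flip: insert.IH)
    qed simp
    have le: "(SUP x\<in>Rvec I. \<Sum>i\<in>I. h i (x i)) \<le> (\<Sum>i\<in>I. SUP t. h i t)"
      by (intro SUP_least sum_mono SUP_upper) simp
    \<comment> \<open>Points outside \<open>D i\<close> have \<open>h i t = -\<infinity>\<close>, so
      discarding them does not lower the supremum.\<close>
    have "(\<Sum>i\<in>I. SUP t. h i t) \<le> (\<Sum>i\<in>I. SUP t\<in>D i. h i t)"
    proof (intro sum_mono SUP_least)
      fix i t
      show "h i t \<le> (SUP t\<in>D i. h i t)"
        by (cases "t \<in> D i") (auto intro: SUP_upper simp: D_def h_def)
    qed
    also have "\<dots> = (SUP x\<in>Pi\<^sub>E I D. \<Sum>i\<in>I. h i (x i))"
    proof (rule sum_SUP_PiE_ereal[OF assms(1)])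
      fix i assume "i \<in> I"
      then show "D i \<noteq> {}" using assms(2) by (auto simp: D_def proper_def)
      fix t assume "t \<in> D i"
      then show "h i t \<noteq> -\<infinity>" using ninf[OF \<open>i \<in> I\<close>, of t]
        by (cases "c i t") (auto simp: D_def h_def)
    qed
    also have "\<dots> \<le> (SUP x\<in>Rvec I. \<Sum>i\<in>I. h i (x i))"
      by (rule SUP_subset_mono) (auto simp: Rvec_def)
    finally have "(SUP x\<in>Rvec I. \<Sum>i\<in>I. h i (x i)) = (\<Sum>i\<in>I. SUP t. h i t)"
      using le by (rule antisym[rotated])
    then show ?thesis
      using True by (simp add: conjugate_def separable_sum_def conjugate1_def h_sum h_def[symmetric])
  qed (simp add: conjugate_def separable_sum_def)
qed


section \<open>Operations on separable functions\<close>

lemma sf_conjugate_sf_sub: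
  assumes "is_sepfun N \<phi>" "I \<subseteq> N"
  shows "sf_conjugate (sf_sub I \<phi>) = sf_sub I (sf_conjugate \<phi>)"
proof -
  have "finite I" "\<And>i. i \<in> I \<Longrightarrow> proper (sf_comp \<phi> i)"
    using assms finite_subset by (auto simp: is_sepfun_def closed_proper_convex_def)
  then have "conjugate I (separable_sum I (sf_comp \<phi>))
      = separable_sum I (\<lambda>i. conjugate1 (sf_comp \<phi> i))"
    by (rule conjugate_separable_sum)
  also have "\<dots> = separable_sum I (\<lambda>i\<in>N. conjugate1 (sf_comp \<phi> i))"
    using assms by (intro separable_sum_cong) auto
  finally show ?thesis
    using assms by (auto simp: sf_conjugate_def sf_sub_def is_sepfun_def fun_eq_iff)
qed

text \<open>Sample screening of the dual subtracts the conjugate of a part of \<open>g^*\<close>;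
  Fenchel-Moreau in each coordinate turns this biconjugate back into the corresponding part of
  \<open>g\<close>.\<close>

lemma sf_val_sf_conjugate_sf_sub_sf_conjugate:
  assumes "is_sepfun N \<phi>" "I \<subseteq> N"
  shows "sf_val (sf_conjugate (sf_sub I (sf_conjugate \<phi>))) = sf_val (sf_sub I \<phi>)"
proof -
  have "finite I" and cpc: "\<And>i. i \<in> I \<Longrightarrow> closed_proper_convex (sf_comp \<phi> i)"
    using assms finite_subset by (auto simp: is_sepfun_def)
  have "separable_sum I (\<lambda>i\<in>N. conjugate1 (sf_comp \<phi> i))
      = separable_sum I (\<lambda>i. conjugate1 (sf_comp \<phi> i))"
    using assms by (intro separable_sum_cong) auto
  then have "conjugate I (separable_sum I (\<lambda>i\<in>N. conjugate1 (sf_comp \<phi> i)))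
      = conjugate I (separable_sum I (\<lambda>i. conjugate1 (sf_comp \<phi> i)))"
    by simp
  also have "\<dots> = separable_sum I (\<lambda>i. conjugate1 (conjugate1 (sf_comp \<phi> i)))"
    using \<open>finite I\<close> cpc by (intro conjugate_separable_sum proper_conjugate1)
  also have "\<dots> = separable_sum I (sf_comp \<phi>)"
    using cpc by (intro separable_sum_cong conjugate1_conjugate1 refl)
  finally show ?thesis
    using assms by (simp add: sf_conjugate_def sf_sub_def is_sepfun_def)
qed

lemma sf_conjugate_sf_dom_translate:
  assumes "\<And>i. i \<in> sf_idx \<phi> \<Longrightarrow> d i = - b i"
  shows "sf_conjugate (sf_dom_translate b \<phi>) = sf_slope_translate d (sf_conjugate \<phi>)"
  using assms conjugate_dom_translate[of "sf_idx \<phi>" d b]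
  by (auto simp: sf_conjugate_def sf_dom_translate_def sf_slope_translate_def
      conjugate1_dom_translate fun_eq_iff)

lemma sf_conjugate_sf_slope_translate:
  assumes "\<And>i. i \<in> sf_idx \<phi> \<Longrightarrow> b i = - d i"
  shows "sf_conjugate (sf_slope_translate d \<phi>) = sf_dom_translate b (sf_conjugate \<phi>)"
  using assms conjugate_slope_translate[of "sf_idx \<phi>" b d]
  by (auto simp: sf_conjugate_def sf_dom_translate_def sf_slope_translate_def
      conjugate1_slope_translate fun_eq_iff)


section \<open>Screening and duality\<close>

lemma fr_dual_feature_screen:
  assumes "is_sepfun N (fr_g p)" "I \<subseteq> N" "\<bar>fr_a p\<bar> \<noteq> \<infinity>"
  shows "fr_dual (feature_screen I z p) = sample_screen I z (fr_dual p)"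
proof -
  have N: "fr_cols p = N" using assms(1) by (simp add: is_sepfun_def)
  let ?M = "fr_rows p" and ?I' = "N - I"
  let ?B = "neg_mat N ?M (transp ?M N (fr_A p))"
  \<comment> \<open>Transposing the rows \<open>?I'\<close> of the dual matrix recovers the columns
    \<open>?I'\<close> of the original with opposite sign, exactly the sign change that conjugating
    a domain translation calls for.\<close>
  have f: "sf_conjugate (sf_dom_translate (mat_vec ?M ?I' (submat ?M ?I' (fr_A p)) z) (fr_f p))
      = sf_slope_translate (mat_vec ?M ?I' (transp ?I' ?M (submat ?I' ?M ?B)) z)
          (sf_conjugate (fr_f p))"
    by (rule sf_conjugate_sf_dom_translate)
      (auto simp: mat_vec_def submat_def transp_def neg_mat_def simp flip: sum_negf
        intro!: sum.cong)
  have A: "neg_mat I ?M (transp ?M I (submat ?M I (fr_A p))) = submat I ?M ?B"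
    using assms(2) by (auto simp: neg_mat_def transp_def submat_def fun_eq_iff)
  \<comment> \<open>Here \<open>u\<close> may be infinite; finiteness of \<open>fr_a p\<close>
    prevents a sum of opposite infinities.\<close>
  have a: "- (fr_a p + u) = - fr_a p - u" for u
    using assms(3) by (cases "fr_a p"; cases u) auto
  show ?thesis
    using f A a sf_conjugate_sf_sub[OF assms(1,2)]
      sf_val_sf_conjugate_sf_sub_sf_conjugate[OF assms(1), of ?I']
    by (simp add: fr_dual_def feature_screen_def sample_screen_def Let_def N
        sf_conjugate_def[of "fr_g p"] sf_conjugate_def[of "fr_f p"]
        sf_dom_translate_def sf_sub_def)
qed

text \<open>No biconjugate arises: both constants contain the conjugate of the discarded part of
  \<open>f\<close>. Commuting conjugation with restriction is applied to \<open>J\<close> for the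
  function and to \<open>?J'\<close> for the constant.\<close>

lemma fr_dual_sample_screen:
  assumes "is_sepfun M (fr_f p)" "J \<subseteq> M" "\<bar>fr_a p\<bar> \<noteq> \<infinity>"
  shows "fr_dual (sample_screen J s p) = feature_screen J s (fr_dual p)"
proof -
  have M: "fr_rows p = M" using assms(1) by (simp add: is_sepfun_def)
  let ?N = "fr_cols p" and ?J' = "M - J"
  let ?B = "neg_mat ?N M (transp M ?N (fr_A p))"
  have g: "sf_conjugate (sf_slope_translate
        (mat_vec ?N ?J' (transp ?J' ?N (submat ?J' ?N (fr_A p))) s) (fr_g p))
      = sf_dom_translate (mat_vec ?N ?J' (submat ?N ?J' ?B) s) (sf_conjugate (fr_g p))"
    by (rule sf_conjugate_sf_slope_translate)
      (auto simp: mat_vec_def submat_def transp_def neg_mat_def simp flip: sum_negf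
        intro!: sum.cong)
  have A: "neg_mat ?N J (transp J ?N (submat J ?N (fr_A p))) = submat ?N J ?B"
    using assms(2) by (auto simp: neg_mat_def transp_def submat_def fun_eq_iff)
  have a: "- (fr_a p - u) = - fr_a p + u" for u
    using assms(3) by (cases "fr_a p"; cases u) auto
  show ?thesis
    using g A a sf_conjugate_sf_sub[OF assms(1,2)] sf_conjugate_sf_sub[OF assms(1), of ?J']
    by (simp add: fr_dual_def feature_screen_def sample_screen_def Let_def M
        sf_conjugate_def[of "fr_g p"] sf_conjugate_def[of "fr_f p"]
        sf_slope_translate_def sf_sub_def)
qed

theorem theorem3p10:
  fixes m n :: nat and p :: fr_rep
  assumes "p \<in> Gamma_FR m n"
  shows "(\<forall>I I' z. I \<union> I' = {1..n} \<and> I \<inter> I' = {} \<and> z \<in> Rvec I' \<longrightarrow>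
            fr_dual (feature_screen I z p) = sample_screen I z (fr_dual p)) \<and>
         (\<forall>J J' s. J \<union> J' = {1..m} \<and> J \<inter> J' = {} \<and> s \<in> Rvec J' \<longrightarrow>
            fr_dual (sample_screen J s p) = feature_screen J s (fr_dual p))"
proof -
  have "is_sepfun {1..m} (fr_f p)" "is_sepfun {1..n} (fr_g p)" "\<bar>fr_a p\<bar> \<noteq> \<infinity>"
    using assms by (auto simp: Gamma_FR_def)
  then show ?thesis
    using fr_dual_feature_screen fr_dual_sample_screen by (metis sup_ge1)
qed

end
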